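(* Let $k$ be a positive integer, let $G$ and $H$ be disjoint connected graphs, $a\in V(G)$ and $b\in V(H)$. Then \[{\rm dim}_k((G\cdot H)(a;b)) \geq {\rm dim}_k(G(a))+{\rm dim}_k(H(b))\quad\text{and}\quad {\rm dim}_k((G\sim H)(a;b)) \geq {\rm dim}_k(G(a))+{\rm dim}_k(H(b)).\]
   Context: All graphs are finite, simple and connected; $d_G(u,v)$ is the shortest-path distance in $G$. For a positive integer $k$, a set $S\subseteq V(G)$ is a $k$-metric generator for $G$ if for every pair of distinct vertices $x,y\in V(G)$ there are at least $k$ vertices $s\in S$ with $d_G(s,x)\neq d_G(s,y)$; ${\rm dim}_k(G)$ is the minimum cardinality of such a set, with ${\rm dim}_k(G)=\infty$ if none exists. For $X\subseteq V(G)$, $S$ is a $k$-metric generator for $X$ if every pair of distinct vertices of $X$ is distinguished by at least $k$ vertices of $S$ (if $|X|\le1$, $S=\emptyset$ qualifies). For $v\in V(G)$ and integer $\ell\ge0$, $N_\ell(v)=\{x\in V(G): d_G(v,x)=\ell\}$. ${\rm dim}_k(G(a))$ is the size of a smallest set $S\subseteq V(G)$ such that for every $\ell\ge1$, every pair of distinct vertices of $N_\ell(a)$ is distinguished (with respect to $d_G$) by at least $k$ vertices of $S$ ($\infty$ if no such set exists); ${\rm dim}_k(H(b))$ is defined analogously. The splice $(G\cdot H)(a;b)$ is the graph obtained from $G$ and $H$ by identifying $a$ and $b$; the link $(G\sim H)(a;b)$ is the graph obtained from $G$ and $H$ by adding the edge $ab$. *)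

theory Defs
  imports "Graph_Theory.Graph_Theory" "HOL-Library.Extended_Nat"
begin

(* Length of a shortest walk. The library's shortest-path weight is extended-real valued: it is a
   natural number on vertices of a connected graph, and infinity when no walk exists. *)
definition graph_dist :: "'a pair_pre_digraph \<Rightarrow> 'a \<Rightarrow> 'a \<Rightarrow> ereal" where
  "graph_dist G u v = wf_digraph.\<mu> (with_proj G) (\<lambda>_. 1) u v"

definition sphere_verts :: "'a pair_pre_digraph \<Rightarrow> nat \<Rightarrow> 'a \<Rightarrow> 'a set" where
  "sphere_verts G l v = {x \<in> pverts G. graph_dist G v x = ereal (real l)}"

definition metric_generator_for ::
    "'a pair_pre_digraph \<Rightarrow> nat \<Rightarrow> 'a set \<Rightarrow> 'a set \<Rightarrow> bool" where
  "metric_generator_for G k X S \<longleftrightarrow>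
     S \<subseteq> pverts G \<and>
     (\<forall>x\<in>X. \<forall>y\<in>X. x \<noteq> y \<longrightarrow> k \<le> card {s \<in> S. graph_dist G s x \<noteq> graph_dist G s y})"

definition metric_generator :: "'a pair_pre_digraph \<Rightarrow> nat \<Rightarrow> 'a set \<Rightarrow> bool" where
  "metric_generator G k S \<longleftrightarrow> metric_generator_for G k (pverts G) S"

(* In enat every nonempty set attains its infimum, and the infimum of the empty set is infinity. *)
definition metric_dim :: "nat \<Rightarrow> 'a pair_pre_digraph \<Rightarrow> enat" where
  "metric_dim k G = (INF S \<in> {S. metric_generator G k S}. enat (card S))"

definition rooted_metric_dim :: "nat \<Rightarrow> 'a pair_pre_digraph \<Rightarrow> 'a \<Rightarrow> enat" where
  "rooted_metric_dim k G a =
     (INF S \<in> {S. S \<subseteq> pverts G \<and> (\<forall>l\<ge>1. metric_generator_for G k (sphere_verts G l a) S)}.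
        enat (card S))"

(* The vertex b of H is renamed to a, so the identified vertex carries the name a. As with the link,
   this is the intended graph only when the vertex sets of G and H are disjoint. *)
definition splice_graph ::
    "'a pair_pre_digraph \<Rightarrow> 'a pair_pre_digraph \<Rightarrow> 'a \<Rightarrow> 'a \<Rightarrow> 'a pair_pre_digraph" where
  "splice_graph G H a b =
     (let r = id(b := a) in
      \<lparr> pverts = pverts G \<union> r ` pverts H,
        parcs = parcs G \<union> map_prod r r ` parcs H \<rparr>)"

definition link_graph ::
    "'a pair_pre_digraph \<Rightarrow> 'a pair_pre_digraph \<Rightarrow> 'a \<Rightarrow> 'a \<Rightarrow> 'a pair_pre_digraph" where
  "link_graph G H a b =
     \<lparr> pverts = pverts G \<union> pverts H,
       parcs = parcs G \<union> parcs H \<union> {(a, b), (b, a)} \<rparr>"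

end

(* Both graphs are made of a copy of G and a copy of H such that every walk entering a copy does so
   through its root. Hence distances inside a copy are unchanged, and a vertex s that lies outside
   a copy, or is its root, is equally far from all members of a sphere around that root. So the
   vertices of a generator that distinguish members of such a sphere are non-root vertices of the
   copy, and the two copies have no non-root vertex in common. *)

theory Submission
  imports Defs
begin

section \<open>Distances as least exponents of relation powers\<close>

text \<open>Replaces arc lists by powers of the arc relation, so that walks can be cut, joined and
  mapped by induction on their length. The hypothesis on \<open>u\<close> guards length 0: an empty
  walk must sit at a vertex, whereas the zeroth power relates everything to itself.\<close>

lemma (in wf_digraph) awalk_length_iff_relpow:
  assumes "u \<in> verts G"
  shows "(\<exists>p. awalk u p v \<and> length p = n) \<longleftrightarrow> (u, v) \<in> arcs_ends G ^^ n"
  using assms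
proof (induction n arbitrary: u)
  case 0
  then show ?case by (auto simp: awalk_def)
next
  case (Suc n)
  have "(\<exists>p. awalk u p v \<and> length p = Suc n)
      \<longleftrightarrow> (\<exists>e p. e \<in> arcs G \<and> tail G e = u \<and> awalk (head G e) p v \<and> length p = n)"
    (is "?L \<longleftrightarrow> ?R")
  proof
    assume ?L
    then show ?R unfolding length_Suc_conv by (metis awalk_Cons_iff)
  next
    assume ?R
    then obtain e p where "e \<in> arcs G" "tail G e = u" "awalk (head G e) p v" "length p = n"
      by blast
    then show ?L by (intro exI[of _ "e # p"]) (auto simp: awalk_Cons_iff)
  qed
  also have "\<dots> \<longleftrightarrow> (\<exists>e. e \<in> arcs G \<and> tail G e = u \<and> (head G e, v) \<in> arcs_ends G ^^ n)"
    using Suc.IH[OF head_in_verts] by metis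
  also have "\<dots> \<longleftrightarrow> (u, v) \<in> arcs_ends G ^^ Suc n"
    by (fastforce simp: arcs_ends_conv simp del: relpow.simps
        elim: relpow_Suc_E2 intro: relpow_Suc_I2)
  finally show ?case .
qed

lemma graph_dist_eq_INF:
  assumes "pair_wf_digraph G" and "u \<in> pverts G"
  shows "graph_dist G u v = (INF n \<in> {n. (u, v) \<in> parcs G ^^ n}. ereal (real n))"
proof -
  interpret pair_wf_digraph G by fact
  have ends: "arcs_ends (with_proj G) = parcs G"
    by (auto simp: arcs_ends_conv)
  have "(\<lambda>p. ereal (awalk_cost (\<lambda>_. 1) p)) ` {p. awalk u p v}
      = (\<lambda>n. ereal (real n)) ` length ` {p. awalk u p v}"
    by (simp add: awalk_cost_def image_image sum_list_triv)
  also have "length ` {p. awalk u p v} = {n. (u, v) \<in> parcs G ^^ n}"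
    using awalk_length_iff_relpow[of u v] assms(2) by (auto simp: ends image_iff) metis
  finally show ?thesis
    by (simp add: graph_dist_def \<mu>_def)
qed

text \<open>Compares distances in two different graphs by turning each walk of one into a walk of
  the other that is no longer. Infinite distances are covered, being infima of the empty
  set.\<close>

lemma graph_dist_mono:
  assumes "pair_wf_digraph G" "u \<in> pverts G" "pair_wf_digraph K" "p \<in> pverts K"
    and "\<And>n. (p, q) \<in> parcs K ^^ n \<Longrightarrow> \<exists>m\<le>n. (u, v) \<in> parcs G ^^ m"
  shows "graph_dist G u v \<le> graph_dist K p q"
  unfolding graph_dist_eq_INF[OF assms(1,2)] graph_dist_eq_INF[OF assms(3,4)]
  using assms(5) by (intro INF_mono) auto

lemma graph_dist_le_iff_relpow:
  assumes "pair_wf_digraph G" and "u \<in> pverts G"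
  shows "graph_dist G u v \<le> ereal (real n) \<longleftrightarrow> (\<exists>m\<le>n. (u, v) \<in> parcs G ^^ m)"
proof
  assume le: "graph_dist G u v \<le> ereal (real n)"
  \<comment> \<open>A strict upper bound on an infimum yields a member below it; integrality of
    lengths turns \<open>< Suc n\<close> back into \<open>\<le> n\<close>.\<close>
  have "graph_dist G u v < ereal (real (Suc n))"
    using le by (rule order.strict_trans1) simp
  then obtain m where "(u, v) \<in> parcs G ^^ m" "m < Suc n"
    by (auto simp: graph_dist_eq_INF[OF assms] INF_less_iff)
  then show "\<exists>m\<le>n. (u, v) \<in> parcs G ^^ m"
    by (auto simp: less_Suc_eq_le)
next
  assume "\<exists>m\<le>n. (u, v) \<in> parcs G ^^ m"
  then show "graph_dist G u v \<le> ereal (real n)"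
    by (auto simp: graph_dist_eq_INF[OF assms] intro: INF_lower2)
qed

section \<open>Distances and generators seen from one rooted copy\<close>

(* f embeds G in K, and \<rho> is the retraction collapsing everything outside the copy to the root. *)
locale branch =
  G: pair_wf_digraph G + K: pair_wf_digraph K
  for G :: "'a pair_pre_digraph" and K :: "'b pair_pre_digraph" +
  fixes a :: 'a and f :: "'a \<Rightarrow> 'b" and \<rho> :: "'b \<Rightarrow> 'a"
  assumes finite_verts: "finite (pverts K)"
    and root: "a \<in> pverts G"
    and verts: "u \<in> pverts G \<Longrightarrow> f u \<in> pverts K"
    and arcs: "(u, v) \<in> parcs G \<Longrightarrow> (f u, f v) \<in> parcs K"
    and retract: "u \<in> pverts G \<Longrightarrow> \<rho> (f u) = u"
    and retract_verts: "p \<in> pverts K \<Longrightarrow> \<rho> p \<in> pverts G"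
    and outside: "p \<in> pverts K \<Longrightarrow> f (\<rho> p) = p \<or> \<rho> p = a"
    and arc_cases: "(p, q) \<in> parcs K \<Longrightarrow>
      (\<rho> p, \<rho> q) \<in> parcs G \<and> f (\<rho> p) = p \<and> f (\<rho> q) = q \<or> \<rho> p = a \<and> \<rho> q = a"
begin

lemma inj: "inj_on f (pverts G)"
  using retract by (rule inj_on_inverseI)

lemma relpow_embed: "(u, v) \<in> parcs G ^^ n \<Longrightarrow> (f u, f v) \<in> parcs K ^^ n"
  by (induction n arbitrary: v) (auto intro: arcs)

text \<open>Arcs inside the copy are kept and all others collapse to the root, so a retracted walk
  can only get shorter.\<close>

lemma relpow_retract: "(p, q) \<in> parcs K ^^ n \<Longrightarrow> \<exists>m\<le>n. (\<rho> p, \<rho> q) \<in> parcs G ^^ m"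
proof (induction n arbitrary: q)
  case 0
  then show ?case by auto
next
  case (Suc n)
  then obtain r where r: "(p, r) \<in> parcs K ^^ n" "(r, q) \<in> parcs K"
    by auto
  then obtain m where m: "m \<le> n" "(\<rho> p, \<rho> r) \<in> parcs G ^^ m"
    using Suc.IH by blast
  from arc_cases[OF r(2)] show ?case
  proof
    assume "(\<rho> r, \<rho> q) \<in> parcs G \<and> f (\<rho> r) = r \<and> f (\<rho> q) = q"
    with m have "(\<rho> p, \<rho> q) \<in> parcs G ^^ Suc m" by auto
    with m(1) show ?thesis by (meson Suc_le_mono)
  next
    assume "\<rho> r = a \<and> \<rho> q = a"
    with m show ?thesis by (metis le_SucI)
  qed
qed

lemma graph_dist_embed:
  assumes "u \<in> pverts G" "v \<in> pverts G"
  shows "graph_dist K (f u) (f v) = graph_dist G u v"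
proof (rule antisym)
  show "graph_dist K (f u) (f v) \<le> graph_dist G u v"
    using assms relpow_embed
    by (intro graph_dist_mono verts G.pair_wf_digraph_axioms K.pair_wf_digraph_axioms) auto
  show "graph_dist G u v \<le> graph_dist K (f u) (f v)"
    using assms relpow_retract[of "f u" "f v"]
    by (intro graph_dist_mono verts G.pair_wf_digraph_axioms K.pair_wf_digraph_axioms)
      (auto simp: retract)
qed

text \<open>The walk is cut at its first visit to \<open>f a\<close>: the part before it stays in
  \<open>K\<close>, the part after it is retracted to \<open>G\<close>.\<close>

lemma relpow_through_root:
  assumes "(p, f x) \<in> parcs K ^^ n" "\<rho> p = a" "x \<in> pverts G"
  shows "\<exists>i m. i + m \<le> n \<and> (p, f a) \<in> parcs K ^^ i \<and> (a, x) \<in> parcs G ^^ m"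
  using assms
proof (induction n arbitrary: p)
  case 0
  then have "x = a" "p = f a"
    using retract by auto
  then have "(p, f a) \<in> parcs K ^^ 0 \<and> (a, x) \<in> parcs G ^^ 0"
    by simp
  then show ?case by fastforce
next
  case (Suc n)
  show ?case
  proof (cases "p = f a")
    case True
    \<comment> \<open>All of the remaining walk, with any excursions out of the copy, is retracted
      at once.\<close>
    then obtain m where "m \<le> Suc n" "(a, x) \<in> parcs G ^^ m"
      using relpow_retract[OF Suc.prems(1)] Suc.prems(2,3) retract by auto
    moreover have "(p, f a) \<in> parcs K ^^ 0"
      using True by simp
    ultimately show ?thesis by (metis add_0)
  next
    case False
    obtain q where q: "(p, q) \<in> parcs K" "(q, f x) \<in> parcs K ^^ n"
      using Suc.prems(1) by (blast elim: relpow_Suc_E2)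
    then have "\<rho> q = a"
      \<comment> \<open>\<open>p\<close> lies outside the copy, since
        \<open>f (\<rho> p) = f a\<close> differs from \<open>p\<close>; hence the arc to
        \<open>q\<close> is a collapsed one.\<close>
      using arc_cases[OF q(1)] False Suc.prems(2) by auto
    with q(2) Suc.IH Suc.prems(3) obtain i m
      where im: "i + m \<le> n" "(q, f a) \<in> parcs K ^^ i" "(a, x) \<in> parcs G ^^ m"
      by blast
    then have "(p, f a) \<in> parcs K ^^ Suc i"
      using q(1) by (blast intro: relpow_Suc_I2)
    moreover have "Suc i + m \<le> Suc n"
      using im(1) by simp
    ultimately show ?thesis using im(3) by blast
  qed
qed

text \<open>After reaching the root, a walk to \<open>f x\<close> spends at least \<open>l\<close>
  steps in the copy; that part can be exchanged for a shortest walk to \<open>f y\<close>. The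
  hypotheses are symmetric in \<open>x\<close> and \<open>y\<close>, so equality follows by swapping
  them.\<close>

lemma graph_dist_sphere_le:
  assumes "p \<in> pverts K" "\<rho> p = a" "x \<in> sphere_verts G l a" "y \<in> sphere_verts G l a"
  shows "graph_dist K p (f y) \<le> graph_dist K p (f x)"
proof (intro graph_dist_mono K.pair_wf_digraph_axioms assms(1))
  fix n assume n: "(p, f x) \<in> parcs K ^^ n"
  have x: "x \<in> pverts G" "graph_dist G a x = ereal (real l)"
    and y: "graph_dist G a y = ereal (real l)"
    using assms(3,4) by (auto simp: sphere_verts_def)
  note le_iff = graph_dist_le_iff_relpow[OF G.pair_wf_digraph_axioms root]
  obtain i m where im: "i + m \<le> n" "(p, f a) \<in> parcs K ^^ i" "(a, x) \<in> parcs G ^^ m"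
    using relpow_through_root[OF n assms(2) x(1)] by blast
  from im(3) have "graph_dist G a x \<le> ereal (real m)"
    by (auto simp: le_iff)
  then have "l \<le> m"
    by (simp add: x)
  obtain j where j: "j \<le> l" "(a, y) \<in> parcs G ^^ j"
    using y le_iff[of y l] by auto
  have "(p, f y) \<in> parcs K ^^ (i + j)"
    using im(2) relpow_embed[OF j(2)] by (auto simp: relpow_add)
  moreover have "i + j \<le> n"
    using im(1) \<open>l \<le> m\<close> j(1) by simp
  ultimately show "\<exists>m\<le>n. (p, f y) \<in> parcs K ^^ m"
    by blast
qed

text \<open>A vertex of \<open>S\<close> separating \<open>f x\<close> from \<open>f y\<close>
  cannot retract to the root, so it is the image of a non-root vertex of \<open>G\<close>, which
  separates \<open>x\<close> from \<open>y\<close> because distances are preserved.\<close>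

lemma metric_generator_for_sphere:
  assumes "metric_generator K k S"
  shows "metric_generator_for G k (sphere_verts G l a) {t \<in> pverts G - {a}. f t \<in> S}"
    (is "metric_generator_for _ _ _ ?T")
proof -
  have S: "S \<subseteq> pverts K"
    and card_S: "\<And>p q. p \<in> pverts K \<Longrightarrow> q \<in> pverts K \<Longrightarrow> p \<noteq> q \<Longrightarrow>
      k \<le> card {s \<in> S. graph_dist K s p \<noteq> graph_dist K s q}"
    using assms by (auto simp: metric_generator_def metric_generator_for_def)
  \<comment> \<open>Needed for the counting below, since \<open>card\<close> of an infinite set is
    0.\<close>
  have "finite ?T"
    by (rule inj_on_finite[OF inj_on_subset[OF inj] _ finite_verts]) (auto intro: verts)
  have "k \<le> card {t \<in> ?T. graph_dist G t x \<noteq> graph_dist G t y}"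
    if xy: "x \<in> sphere_verts G l a" "y \<in> sphere_verts G l a" "x \<noteq> y" for x y
  proof -
    have verts_xy: "x \<in> pverts G" "y \<in> pverts G"
      using xy by (auto simp: sphere_verts_def)
    have "s \<in> f ` {t \<in> ?T. graph_dist G t x \<noteq> graph_dist G t y}"
      if s: "s \<in> S" "graph_dist K s (f x) \<noteq> graph_dist K s (f y)" for s
    proof -
      have "s \<in> pverts K" using s S by auto
      have "\<rho> s \<noteq> a"
        using s(2) graph_dist_sphere_le[OF \<open>s \<in> pverts K\<close>] xy by (meson antisym)
      then have "f (\<rho> s) = s" "\<rho> s \<in> pverts G"
        using outside retract_verts \<open>s \<in> pverts K\<close> by auto
      then show ?thesis
        using s \<open>\<rho> s \<noteq> a\<close> graph_dist_embed[of "\<rho> s"] verts_xy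
        by (intro image_eqI[of _ _ "\<rho> s"]) auto
    qed
    then have "card {s \<in> S. graph_dist K s (f x) \<noteq> graph_dist K s (f y)}
        \<le> card {t \<in> ?T. graph_dist G t x \<noteq> graph_dist G t y}"
      using finite_Collect_conjI[OF disjI1, of "\<lambda>t. t \<in> ?T"] \<open>finite ?T\<close>
      by (intro surj_card_le[where f = f] subsetI) simp_all
    moreover have "f x \<noteq> f y"
      using xy(3) verts_xy retract by metis
    ultimately show ?thesis
      using card_S[of "f x" "f y"] verts verts_xy by (meson order_trans)
  qed
  then show ?thesis
    by (auto simp: metric_generator_for_def)
qed

text \<open>The bound is phrased with a subset of \<open>S\<close> itself, so that the bounds from
  two copies can be added inside \<open>S\<close>.\<close>

lemma rooted_metric_dim_le:
  assumes "metric_generator K k S"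
  shows "rooted_metric_dim k G a \<le> enat (card (S \<inter> f ` (pverts G - {a})))"
proof -
  have "f ` {t \<in> pverts G - {a}. f t \<in> S} = S \<inter> f ` (pverts G - {a})"
    by auto
  then have "card {t \<in> pverts G - {a}. f t \<in> S} = card (S \<inter> f ` (pverts G - {a}))"
    using card_image[OF inj_on_subset[OF inj], of "{t \<in> pverts G - {a}. f t \<in> S}"] by auto
  then show ?thesis
    unfolding rooted_metric_dim_def using metric_generator_for_sphere[OF assms]
    by (intro INF_lower2[of "{t \<in> pverts G - {a}. f t \<in> S}"]) auto
qed

end

section \<open>Two branches in one graph: splice and link\<close>

lemma metric_dim_ge_branches:
  assumes "branch G K a f \<rho>" and "branch H K b g \<sigma>"
    and disjoint: "f ` (pverts G - {a}) \<inter> g ` (pverts H - {b}) = {}"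
  shows "rooted_metric_dim k G a + rooted_metric_dim k H b \<le> metric_dim k K"
  unfolding metric_dim_def
\<comment> \<open>If \<open>K\<close> has no generator, its dimension is infinite and there is
  nothing to check.\<close>
proof (rule INF_greatest)
  interpret G: branch G K a f \<rho> by fact
  interpret H: branch H K b g \<sigma> by fact
  fix S assume "S \<in> {S. metric_generator K k S}"
  then have S: "metric_generator K k S" by simp
  then have fin: "finite S"
    using finite_subset G.finite_verts by (auto simp: metric_generator_def metric_generator_for_def)
  have "rooted_metric_dim k G a + rooted_metric_dim k H b
      \<le> enat (card (S \<inter> f ` (pverts G - {a})) + card (S \<inter> g ` (pverts H - {b})))"
    using add_mono[OF G.rooted_metric_dim_le[OF S] H.rooted_metric_dim_le[OF S]] by simp
  also have "card (S \<inter> f ` (pverts G - {a})) + card (S \<inter> g ` (pverts H - {b}))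
      = card (S \<inter> f ` (pverts G - {a}) \<union> S \<inter> g ` (pverts H - {b}))"
    using fin disjoint by (intro card_Un_disjoint[symmetric]) auto
  also have "enat \<dots> \<le> enat (card S)"
    using fin by (auto intro: card_mono)
  finally show "rooted_metric_dim k G a + rooted_metric_dim k H b \<le> enat (card S)" .
qed

theorem theorem2p4:
  fixes k :: nat and G H :: "'a pair_pre_digraph" and a b :: 'a
  assumes "k \<ge> 1"
    and "pair_graph G" and "connected (with_proj G)"
    and "pair_graph H" and "connected (with_proj H)"
    and "pverts G \<inter> pverts H = {}"
    and "a \<in> pverts G" and "b \<in> pverts H"
  shows "metric_dim k (splice_graph G H a b) \<ge> rooted_metric_dim k G a + rooted_metric_dim k H b
       \<and> metric_dim k (link_graph G H a b) \<ge> rooted_metric_dim k G a + rooted_metric_dim k H b"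
proof
  interpret G: pair_graph G by fact
  interpret H: pair_graph H by fact
  note [simp] = \<open>a \<in> pverts G\<close> \<open>b \<in> pverts H\<close>
  have neq: "u \<noteq> v" if "u \<in> pverts G" "v \<in> pverts H" for u v
    using that assms(6) by auto
  have [simp]: "a \<noteq> b" "b \<noteq> a" "a \<notin> pverts H" "b \<notin> pverts G"
    using neq[of a a] neq[of b b] neq[of a b] by auto
  \<comment> \<open>Serves as \<rho> in all four branches. For \<open>H\<close> in the splice it
    sends the shared vertex \<open>a\<close>, which is not in \<open>pverts H\<close>, back to
    \<open>b\<close>.\<close>
  define retr where "retr V r = (\<lambda>p. if p \<in> V then p else r)" for V :: "'a set" and r
  have arcG: "u \<in> pverts G" "v \<in> pverts G" "u \<notin> pverts H" "v \<notin> pverts H"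
    if "(u, v) \<in> parcs G" for u v
    using that G.in_arcsD1 G.in_arcsD2 neq by blast+
  have arcH: "u \<in> pverts H" "v \<in> pverts H" "u \<notin> pverts G" "v \<notin> pverts G"
    if "(u, v) \<in> parcs H" for u v
    using that H.in_arcsD1 H.in_arcsD2 neq by blast+
  show "rooted_metric_dim k G a + rooted_metric_dim k H b \<le> metric_dim k (link_graph G H a b)"
  proof (rule metric_dim_ge_branches)
    have wf: "pair_wf_digraph (link_graph G H a b)"
      by unfold_locales (auto simp: link_graph_def dest: arcG arcH)
    \<comment> \<open>Both directions of the new edge collapse to the root, as does every arc of the
      other graph.\<close>
    show "branch G (link_graph G H a b) a id (retr (pverts G) a)"
      by (intro branch.intro branch_axioms.intro wf G.pair_wf_digraph_axioms)
        (auto simp: link_graph_def retr_def dest: arcG arcH)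
    show "branch H (link_graph G H a b) b id (retr (pverts H) b)"
      by (intro branch.intro branch_axioms.intro wf H.pair_wf_digraph_axioms)
        (auto simp: link_graph_def retr_def dest: arcG arcH)
    show "id ` (pverts G - {a}) \<inter> id ` (pverts H - {b}) = {}"
      using neq by auto
  qed
  show "rooted_metric_dim k G a + rooted_metric_dim k H b \<le> metric_dim k (splice_graph G H a b)"
  proof (rule metric_dim_ge_branches)
    let ?r = "id(b := a)"
    have wf: "pair_wf_digraph (splice_graph G H a b)"
      by unfold_locales (auto simp: splice_graph_def Let_def dest: arcG arcH split: if_splits)
    show "branch G (splice_graph G H a b) a id (retr (pverts G) a)"
      by (intro branch.intro branch_axioms.intro wf G.pair_wf_digraph_axioms)
        (auto simp: splice_graph_def Let_def retr_def dest: arcG arcH split: if_splits)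
    \<comment> \<open>Here the embedding is the renaming: the root \<open>b\<close> of
      \<open>H\<close> appears in the splice as \<open>a\<close>.\<close>
    show "branch H (splice_graph G H a b) b ?r (retr (pverts H) b)"
      by (intro branch.intro branch_axioms.intro wf H.pair_wf_digraph_axioms)
        (auto simp: splice_graph_def Let_def retr_def intro: rev_image_eqI
          dest: arcG arcH split: if_splits)
    \<comment> \<open>The copies share only \<open>a\<close>, the image of both roots, and it is
      removed on both sides.\<close>
    show "id ` (pverts G - {a}) \<inter> ?r ` (pverts H - {b}) = {}"
      using neq by auto
  qed
qed

end
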